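(* Let $f:\mathbb{R}^2\to\mathbb{R}$, consider the ODE $\frac{du}{dt}=f(t,u)$, with $u$ (at least) twice time-differentiable, and assume that $\left|\frac{\partial f}{\partial u}\right|\le L$. Then there exists $C\in\mathbb{R}^+$ such that the error $\epsilon$ of a $K$-unrolled one-step of an $s$-stage Runge–Kutta method of order $p$, with a time-step $h$, satisfies $$\epsilon\le\left(\frac hK\right)^p\frac CL\left(e^{Lh}-1\right).$$
   Context: An $s$-stage (explicit) Runge–Kutta method is given by real coefficients $a_{ij}$, $b_i$, $c_i$. One step of size $\delta$ from the value $v$ at time $\tau$ gives the approximation $v+\delta\sum_{i=1}^s b_ik_i$ of the solution at time $\tau+\delta$, where $k_1=f(\tau,v)$ and $k_i=f\big(\tau+c_i\delta,\;v+\delta\sum_{j=1}^{i-1}a_{ij}k_j\big)$ for $2\le i\le s$. The method is of order $p$ in the usual sense that the local error of one step of size $\delta$ is $\mathcal{O}(\delta^{p+1})$. The $K$-unrolled one-step with time-step $h$, starting from $u(t)=u_0$, consists of $K$ successive steps of the method, each of size $h/K$. For $i=1,\dots,K$, the value $u_i$ is obtained by one step of size $h/K$ from the value $u_{i-1}$ at time $t+(i-1)\frac hK$. The result $u_K$ is the approximation of $u(t+h)$, where $u$ is the exact solution with $u(t)=u_0$. The error is $\epsilon=|u(t+h)-u_K|$. *)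

theory Defs
  imports "HOL-Analysis.Analysis"
begin

text \<open>
  An explicit Runge--Kutta method; all coefficient indices run from 1.
  Only the entries \<open>rk_A R i j\<close> with \<open>j < i\<close> are used, and \<open>rk_c R 1\<close> is ignored
  because the first stage is always evaluated at the current time.
\<close>

record rk_method =
  rk_stages :: nat
  rk_A :: "nat \<Rightarrow> nat \<Rightarrow> real"
  rk_b :: "nat \<Rightarrow> real"
  rk_c :: "nat \<Rightarrow> real"

fun rk_k :: "rk_method \<Rightarrow> (real \<Rightarrow> real \<Rightarrow> real) \<Rightarrow> real \<Rightarrow> real \<Rightarrow> real \<Rightarrow> nat \<Rightarrow> real" where
  "rk_k R f \<tau> v \<delta> i =
     (if i \<le> 1 then f \<tau> v
      else f (\<tau> + rk_c R i * \<delta>) (v + \<delta> * (\<Sum>j = 1..<i. rk_A R i j * rk_k R f \<tau> v \<delta> j)))"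

text \<open>The unconditional recursion equation would make the simplifier loop.\<close>

declare rk_k.simps [simp del]

definition rk_step :: "rk_method \<Rightarrow> (real \<Rightarrow> real \<Rightarrow> real) \<Rightarrow> real \<Rightarrow> real \<Rightarrow> real \<Rightarrow> real" where
  "rk_step R f \<tau> v \<delta> = v + \<delta> * (\<Sum>i = 1..rk_stages R. rk_b R i * rk_k R f \<tau> v \<delta> i)"

text \<open>
  \<open>rk_iterate R f t u\<^sub>0 \<delta> i\<close> is the value after \<open>i\<close> successive steps of size \<open>\<delta>\<close>
  from the value \<open>u\<^sub>0\<close> at time \<open>t\<close>.
\<close>

primrec rk_iterate ::
  "rk_method \<Rightarrow> (real \<Rightarrow> real \<Rightarrow> real) \<Rightarrow> real \<Rightarrow> real \<Rightarrow> real \<Rightarrow> nat \<Rightarrow> real" where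
  "rk_iterate R f t u\<^sub>0 \<delta> 0 = u\<^sub>0"
| "rk_iterate R f t u\<^sub>0 \<delta> (Suc i) =
     rk_step R f (t + real i * \<delta>) (rk_iterate R f t u\<^sub>0 \<delta> i) \<delta>"

definition unrolled_step ::
  "rk_method \<Rightarrow> (real \<Rightarrow> real \<Rightarrow> real) \<Rightarrow> real \<Rightarrow> real \<Rightarrow> real \<Rightarrow> nat \<Rightarrow> real" where
  "unrolled_step R f t u\<^sub>0 h K = rk_iterate R f t u\<^sub>0 (h / real K) K"

definition ode_solution :: "(real \<Rightarrow> real \<Rightarrow> real) \<Rightarrow> (real \<Rightarrow> real) \<Rightarrow> bool" where
  "ode_solution f u \<longleftrightarrow> (\<forall>\<tau>. (u has_real_derivative f \<tau> (u \<tau>)) (at \<tau>))"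

definition local_error ::
  "rk_method \<Rightarrow> (real \<Rightarrow> real \<Rightarrow> real) \<Rightarrow> (real \<Rightarrow> real) \<Rightarrow> real \<Rightarrow> real \<Rightarrow> real" where
  "local_error R f u \<tau> \<delta> = \<bar>u (\<tau> + \<delta>) - rk_step R f \<tau> (u \<tau>) \<delta>\<bar>"

text \<open>
  Order \<open>p\<close> on the problem with right-hand side \<open>f\<close> and exact solution \<open>u\<close>: the local error is
  \<open>O(\<delta>^(p + 1))\<close> as \<open>\<delta>\<close> tends to 0 from above, uniformly for starting times in a bounded interval.
  Order is relative to the problem because \<open>f\<close> need not be smooth enough for the classical
  order conditions on the coefficients to imply such a bound.
\<close>

definition rk_order ::
  "rk_method \<Rightarrow> (real \<Rightarrow> real \<Rightarrow> real) \<Rightarrow> (real \<Rightarrow> real) \<Rightarrow> nat \<Rightarrow> bool" where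
  "rk_order R f u p \<longleftrightarrow>
     (\<forall>T\<^sub>0 T\<^sub>1. \<exists>M. \<forall>\<^sub>F \<delta> in at_right 0. \<forall>\<tau>\<in>{T\<^sub>0..T\<^sub>1}. local_error R f u \<tau> \<delta> \<le> M * \<delta> ^ (p + 1))"

end

theory Submission
  imports Defs
begin

text \<open>
  The bound on \<open>\<partial>f/\<partial>u\<close> makes one step of the method Lipschitz in its starting value with constant
  \<open>1 + \<Lambda> \<delta>\<close>, where \<open>\<Lambda>\<close> depends on the coefficients and may exceed \<open>L\<close>. Accumulating the local
  errors therefore gives an error of at most \<open>K M \<delta>^(p+1) exp (\<Lambda> h)\<close>; as \<open>h\<close> is bounded by the
  length of the time interval, \<open>exp (\<Lambda> h)\<close> is absorbed into \<open>C\<close>, and \<open>K \<delta> = h \<le> (exp (L h) - 1) / L\<close>.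
  The order hypothesis only controls small \<open>\<delta>\<close>. For the remaining step sizes the local error is
  bounded although \<open>f\<close> need not be continuous in time, because
  \<open>\<bar>f \<sigma> w\<bar> \<le> \<bar>u' \<sigma>\<bar> + L \<bar>w - u \<sigma>\<bar>\<close>.
\<close>

section \<open>Lipschitz dependence of one step on its starting value\<close>

lemma lipschitz_of_deriv_bound:
  fixes g :: "real \<Rightarrow> real"
  assumes "\<And>x. g differentiable (at x)" and "\<And>x. \<bar>deriv g x\<bar> \<le> L"
  shows "\<bar>g v - g w\<bar> \<le> L * \<bar>v - w\<bar>"
proof -
  have "norm (g v - g w) \<le> L * norm (v - w)"
  proof (rule field_differentiable_bound[of UNIV g "deriv g"])
    show "(g has_field_derivative deriv g x) (at x within UNIV)" for x
      using assms(1) by (simp add: DERIV_deriv_iff_real_differentiable)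
  qed (use assms(2) in auto)
  then show ?thesis
    by simp
qed

text \<open>Strong induction on the stage, since a stage may use every earlier one. Capping the step
  size by \<open>D\<close> makes the constant independent of \<open>\<delta>\<close>.\<close>

lemma rk_k_lipschitz:
  assumes lip: "\<And>\<tau> v w. \<bar>f \<tau> v - f \<tau> w\<bar> \<le> L * \<bar>v - w\<bar>"
    and "0 \<le> L" "0 \<le> D"
  shows "\<exists>B\<ge>0. \<forall>\<tau> v w. \<forall>\<delta>\<in>{0..D}. \<bar>rk_k R f \<tau> v \<delta> i - rk_k R f \<tau> w \<delta> i\<bar> \<le> B * \<bar>v - w\<bar>"
proof (induction i rule: less_induct)
  case (less i)
  then obtain B where B: "\<And>j. j < i \<Longrightarrow> B j \<ge> 0"
    "\<And>j \<tau> v w \<delta>. j < i \<Longrightarrow> \<delta> \<in> {0..D} \<Longrightarrow>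
       \<bar>rk_k R f \<tau> v \<delta> j - rk_k R f \<tau> w \<delta> j\<bar> \<le> B j * \<bar>v - w\<bar>"
    by metis
  define S where "S = (\<Sum>j = 1..<i. \<bar>rk_A R i j\<bar> * B j)"
  have "S \<ge> 0"
    unfolding S_def using B(1) by (intro sum_nonneg) auto
  show ?case
  \<comment> \<open>Index 0 falls under the first case too: \<open>rk_k\<close> gives it the same
    value as stage 1, so the claim can range over all natural numbers.\<close>
  proof (cases "i \<le> 1")
    case True
    then show ?thesis
      using lip \<open>0 \<le> L\<close> by (intro exI[of _ L]) (auto simp: rk_k.simps[of _ _ _ _ _ i])
  next
    case False
    \<comment> \<open>The two stage arguments differ by at most \<open>\<bar>v - w\<bar>\<close>
      from the starting values plus \<open>D * S * \<bar>v - w\<bar>\<close> from the earlier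
      stages; f contributes the factor \<open>L\<close>.\<close>
    have "\<bar>rk_k R f \<tau> v \<delta> i - rk_k R f \<tau> w \<delta> i\<bar> \<le> L * (1 + D * S) * \<bar>v - w\<bar>"
      if \<delta>: "\<delta> \<in> {0..D}" for \<tau> v w \<delta>
    proof -
      define V W where "V = (\<Sum>j = 1..<i. rk_A R i j * rk_k R f \<tau> v \<delta> j)"
        and "W = (\<Sum>j = 1..<i. rk_A R i j * rk_k R f \<tau> w \<delta> j)"
      have "\<bar>V - W\<bar> = \<bar>\<Sum>j = 1..<i. rk_A R i j * (rk_k R f \<tau> v \<delta> j - rk_k R f \<tau> w \<delta> j)\<bar>"
        unfolding V_def W_def by (simp add: sum_subtractf right_diff_distrib)
      also have "\<dots> \<le> (\<Sum>j = 1..<i. \<bar>rk_A R i j\<bar> * (B j * \<bar>v - w\<bar>))"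
        using B(2)[OF _ \<delta>]
        by (intro order_trans[OF sum_abs] sum_mono) (auto simp: abs_mult intro!: mult_left_mono)
      also have "\<dots> = S * \<bar>v - w\<bar>"
        unfolding S_def by (simp add: sum_distrib_right mult.assoc)
      finally have VW: "\<bar>V - W\<bar> \<le> S * \<bar>v - w\<bar>" .
      have "\<bar>rk_k R f \<tau> v \<delta> i - rk_k R f \<tau> w \<delta> i\<bar> \<le> L * \<bar>(v + \<delta> * V) - (w + \<delta> * W)\<bar>"
        using lip False unfolding V_def W_def by (simp add: rk_k.simps[of _ _ _ _ _ i])
      also have "\<dots> \<le> L * (\<bar>v - w\<bar> + \<bar>\<delta> * (V - W)\<bar>)"
        using \<open>0 \<le> L\<close> by (intro mult_left_mono) (auto simp: algebra_simps)
      also have "\<dots> \<le> L * (\<bar>v - w\<bar> + D * (S * \<bar>v - w\<bar>))"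
        using \<delta> VW \<open>0 \<le> L\<close> \<open>0 \<le> D\<close> unfolding abs_mult
        by (intro mult_left_mono add_left_mono mult_mono) auto
      finally show ?thesis
        by (simp add: algebra_simps)
    qed
    moreover have "L * (1 + D * S) \<ge> 0"
      using \<open>0 \<le> L\<close> \<open>0 \<le> D\<close> \<open>0 \<le> S\<close> by simp
    ultimately show ?thesis
      by blast
  qed
qed

text \<open>The stages enter a step with a factor \<open>\<delta>\<close>, so the constant exceeds 1
  only by \<open>\<Lambda> * \<delta>\<close>. This keeps the growth over K steps of size h/K below
  \<open>exp (\<Lambda> * h)\<close>, whatever K is.\<close>

lemma rk_step_lipschitz:
  assumes lip: "\<And>\<tau> v w. \<bar>f \<tau> v - f \<tau> w\<bar> \<le> L * \<bar>v - w\<bar>"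
    and "0 \<le> L" "0 \<le> D"
  obtains \<Lambda> where "\<Lambda> \<ge> 0"
    "\<And>\<tau> v w \<delta>. \<delta> \<in> {0..D} \<Longrightarrow> \<bar>rk_step R f \<tau> v \<delta> - rk_step R f \<tau> w \<delta>\<bar> \<le> (1 + \<Lambda> * \<delta>) * \<bar>v - w\<bar>"
proof -
  obtain B where B: "\<And>i. B i \<ge> 0"
    "\<And>i \<tau> v w \<delta>. \<delta> \<in> {0..D} \<Longrightarrow>
       \<bar>rk_k R f \<tau> v \<delta> i - rk_k R f \<tau> w \<delta> i\<bar> \<le> B i * \<bar>v - w\<bar>"
    using rk_k_lipschitz[where f = f and L = L and D = D and R = R, OF assms] by metis
  define \<Lambda> where "\<Lambda> = (\<Sum>i = 1..rk_stages R. \<bar>rk_b R i\<bar> * B i)"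
  have "\<Lambda> \<ge> 0"
    unfolding \<Lambda>_def using B(1) by (intro sum_nonneg) auto
  moreover have "\<bar>rk_step R f \<tau> v \<delta> - rk_step R f \<tau> w \<delta>\<bar> \<le> (1 + \<Lambda> * \<delta>) * \<bar>v - w\<bar>"
    if \<delta>: "\<delta> \<in> {0..D}" for \<tau> v w \<delta>
  proof -
    define d where "d = (\<Sum>i = 1..rk_stages R. rk_b R i * (rk_k R f \<tau> v \<delta> i - rk_k R f \<tau> w \<delta> i))"
    have "\<bar>d\<bar> \<le> (\<Sum>i = 1..rk_stages R. \<bar>rk_b R i\<bar> * (B i * \<bar>v - w\<bar>))"
      unfolding d_def using B(2)[OF \<delta>]
      by (intro order_trans[OF sum_abs] sum_mono) (auto simp: abs_mult intro!: mult_left_mono)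
    also have "\<dots> = \<Lambda> * \<bar>v - w\<bar>"
      unfolding \<Lambda>_def by (simp add: sum_distrib_right mult.assoc)
    finally have "\<delta> * \<bar>d\<bar> \<le> \<delta> * (\<Lambda> * \<bar>v - w\<bar>)"
      using \<delta> by (intro mult_left_mono) auto
    moreover have "rk_step R f \<tau> v \<delta> - rk_step R f \<tau> w \<delta> = (v - w) + \<delta> * d"
      unfolding rk_step_def d_def by (simp add: sum_subtractf right_diff_distrib)
    moreover have "\<bar>(v - w) + \<delta> * d\<bar> \<le> \<bar>v - w\<bar> + \<delta> * \<bar>d\<bar>"
      using abs_triangle_ineq[of "v - w" "\<delta> * d"] \<delta> by (simp add: abs_mult)
    ultimately show ?thesis
      by (simp add: algebra_simps)
  qed
  ultimately show ?thesis
    by (rule that)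
qed

section \<open>Local error bounds for all step sizes up to \<open>D\<close>\<close>

lemma continuous_interval_abs_bound:
  fixes g :: "real \<Rightarrow> real"
  assumes "continuous_on {a..b} g"
  shows "\<exists>B\<ge>0. \<forall>x\<in>{a..b}. \<bar>g x\<bar> \<le> B"
proof -
  have "bounded (g ` {a..b})"
    using assms by (intro compact_imp_bounded compact_continuous_image) auto
  then show ?thesis
    by (auto simp: bounded_pos intro: less_imp_le)
qed

text \<open>Each evaluation of f is compared with the one on the solution curve at the same time,
  where f is bounded by continuity; the Lipschitz bound controls the difference.\<close>

lemma rk_k_bounded:
  assumes lip: "\<And>\<tau> v w. \<bar>f \<tau> v - f \<tau> w\<bar> \<le> L * \<bar>v - w\<bar>"
    and "0 \<le> L" "0 \<le> D"
    and cont: "continuous_on UNIV u" "continuous_on UNIV (\<lambda>\<tau>. f \<tau> (u \<tau>))"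
  shows "\<exists>B\<ge>0. \<forall>\<tau>\<in>{T\<^sub>0..T\<^sub>1}. \<forall>\<delta>\<in>{0..D}. \<bar>rk_k R f \<tau> (u \<tau>) \<delta> i\<bar> \<le> B"
proof (induction i rule: less_induct)
  case (less i)
  then obtain B where B: "\<And>j. j < i \<Longrightarrow> B j \<ge> 0"
    "\<And>j \<tau> \<delta>. j < i \<Longrightarrow> \<tau> \<in> {T\<^sub>0..T\<^sub>1} \<Longrightarrow> \<delta> \<in> {0..D} \<Longrightarrow> \<bar>rk_k R f \<tau> (u \<tau>) \<delta> j\<bar> \<le> B j"
    by metis
  define S where "S = (\<Sum>j = 1..<i. \<bar>rk_A R i j\<bar> * B j)"
  have "S \<ge> 0"
    unfolding S_def using B(1) by (intro sum_nonneg) auto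
  \<comment> \<open>The largest shift of a stage time. Nodes may be negative or exceed 1, so the
    time interval is widened on both sides.\<close>
  define c where "c = \<bar>rk_c R i\<bar> * D"
  have "c \<ge> 0"
    unfolding c_def using \<open>0 \<le> D\<close> by simp
  obtain U where U: "U \<ge> 0" "\<And>\<sigma>. \<sigma> \<in> {T\<^sub>0 - c..T\<^sub>1 + c} \<Longrightarrow> \<bar>u \<sigma>\<bar> \<le> U"
    using continuous_interval_abs_bound[OF continuous_on_subset[OF cont(1) subset_UNIV]] by blast
  obtain F where F: "F \<ge> 0" "\<And>\<sigma>. \<sigma> \<in> {T\<^sub>0 - c..T\<^sub>1 + c} \<Longrightarrow> \<bar>f \<sigma> (u \<sigma>)\<bar> \<le> F"
    using continuous_interval_abs_bound[OF continuous_on_subset[OF cont(2) subset_UNIV]] by blast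
  show ?case
  proof (cases "i \<le> 1")
    case True
    then show ?thesis
      using F \<open>c \<ge> 0\<close> by (intro exI[of _ F]) (auto simp: rk_k.simps[of _ _ _ _ _ i])
  next
    case False
    \<comment> \<open>\<open>F\<close> bounds f on the solution curve, and
      \<open>2 * U + D * S\<close> bounds the distance of the stage argument from
      \<open>u \<sigma>\<close>.\<close>
    have "\<bar>rk_k R f \<tau> (u \<tau>) \<delta> i\<bar> \<le> F + L * (2 * U + D * S)"
      if \<tau>: "\<tau> \<in> {T\<^sub>0..T\<^sub>1}" and \<delta>: "\<delta> \<in> {0..D}" for \<tau> \<delta>
    proof -
      define \<sigma> where "\<sigma> = \<tau> + rk_c R i * \<delta>"
      define V where "V = (\<Sum>j = 1..<i. rk_A R i j * rk_k R f \<tau> (u \<tau>) \<delta> j)"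
      have "\<bar>rk_c R i * \<delta>\<bar> \<le> c"
        unfolding c_def abs_mult using \<delta> by (intro mult_left_mono) auto
      then have \<sigma>: "\<sigma> \<in> {T\<^sub>0 - c..T\<^sub>1 + c}"
        unfolding \<sigma>_def using \<tau> by auto
      have "\<bar>V\<bar> \<le> S"
        unfolding V_def S_def using B(2)[OF _ \<tau> \<delta>]
        by (intro order_trans[OF sum_abs] sum_mono) (auto simp: abs_mult intro!: mult_left_mono)
      then have "\<bar>\<delta> * V\<bar> \<le> D * S"
        unfolding abs_mult using \<delta> by (intro mult_mono) auto
      moreover have "\<bar>u \<tau>\<bar> \<le> U" "\<bar>u \<sigma>\<bar> \<le> U"
        using U(2) \<tau> \<sigma> \<open>c \<ge> 0\<close> by auto
      ultimately have "L * \<bar>(u \<tau> + \<delta> * V) - u \<sigma>\<bar> \<le> L * (2 * U + D * S)"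
        using \<open>0 \<le> L\<close> by (intro mult_left_mono) linarith+
      then have "\<bar>f \<sigma> (u \<tau> + \<delta> * V)\<bar> \<le> F + L * (2 * U + D * S)"
        using lip[of \<sigma> "u \<tau> + \<delta> * V" "u \<sigma>"] F(2)[OF \<sigma>] by linarith
      then show ?thesis
        using False unfolding V_def \<sigma>_def by (simp add: rk_k.simps[of _ _ _ _ _ i])
    qed
    moreover have "F + L * (2 * U + D * S) \<ge> 0"
      using F(1) U(1) \<open>0 \<le> L\<close> \<open>0 \<le> D\<close> \<open>0 \<le> S\<close> by simp
    ultimately show ?thesis
      by blast
  qed
qed

text \<open>A bound without any power of \<open>\<delta>\<close>, meant for step sizes bounded away
  from 0.\<close>

lemma local_error_bounded:
  assumes lip: "\<And>\<tau> v w. \<bar>f \<tau> v - f \<tau> w\<bar> \<le> L * \<bar>v - w\<bar>"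
    and "0 \<le> L" "0 \<le> D"
    and cont: "continuous_on UNIV u" "continuous_on UNIV (\<lambda>\<tau>. f \<tau> (u \<tau>))"
  obtains E where "E \<ge> 0"
    "\<And>\<tau> \<delta>. \<tau> \<in> {T\<^sub>0..T\<^sub>1} \<Longrightarrow> \<delta> \<in> {0..D} \<Longrightarrow> local_error R f u \<tau> \<delta> \<le> E"
proof -
  obtain B where B: "\<And>i. B i \<ge> 0"
    "\<And>i \<tau> \<delta>. \<tau> \<in> {T\<^sub>0..T\<^sub>1} \<Longrightarrow> \<delta> \<in> {0..D} \<Longrightarrow> \<bar>rk_k R f \<tau> (u \<tau>) \<delta> i\<bar> \<le> B i"
    using rk_k_bounded[where f = f and L = L and D = D and R = R and u = u, OF assms] by metis
  obtain U where U: "U \<ge> 0" "\<And>\<sigma>. \<sigma> \<in> {T\<^sub>0..T\<^sub>1 + D} \<Longrightarrow> \<bar>u \<sigma>\<bar> \<le> U"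
    using continuous_interval_abs_bound[OF continuous_on_subset[OF cont(1) subset_UNIV]] by blast
  define S where "S = (\<Sum>i = 1..rk_stages R. \<bar>rk_b R i\<bar> * B i)"
  have "S \<ge> 0"
    unfolding S_def using B(1) by (intro sum_nonneg) auto
  then have "2 * U + D * S \<ge> 0"
    using U(1) \<open>0 \<le> D\<close> by simp
  moreover have "local_error R f u \<tau> \<delta> \<le> 2 * U + D * S"
    if \<tau>: "\<tau> \<in> {T\<^sub>0..T\<^sub>1}" and \<delta>: "\<delta> \<in> {0..D}" for \<tau> \<delta>
  proof -
    define V where "V = (\<Sum>i = 1..rk_stages R. rk_b R i * rk_k R f \<tau> (u \<tau>) \<delta> i)"
    have "\<bar>V\<bar> \<le> S"
      unfolding V_def S_def using B(2)[OF \<tau> \<delta>]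
      by (intro order_trans[OF sum_abs] sum_mono) (auto simp: abs_mult intro!: mult_left_mono)
    then have "\<bar>\<delta> * V\<bar> \<le> D * S"
      unfolding abs_mult using \<delta> by (intro mult_mono) auto
    moreover have "\<bar>u \<tau>\<bar> \<le> U" "\<bar>u (\<tau> + \<delta>)\<bar> \<le> U"
      using U(2) \<tau> \<delta> by auto
    ultimately show ?thesis
      unfolding local_error_def rk_step_def V_def by linarith
  qed
  ultimately show ?thesis
    by (rule that)
qed

text \<open>Once \<open>\<delta> \<ge> b > 0\<close>, the power \<open>\<delta> ^ (p + 1)\<close> is
  bounded below, so a constant bound on the local error is also of the required form.\<close>

lemma rk_order_bound_all_steps:
  assumes "rk_order R f u p"
    and bdd: "\<And>\<tau> \<delta>. \<tau> \<in> {T\<^sub>0..T\<^sub>1} \<Longrightarrow> \<delta> \<in> {0..D} \<Longrightarrow> local_error R f u \<tau> \<delta> \<le> E" and "E \<ge> 0"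
  obtains M where "M \<ge> 0"
    "\<And>\<tau> \<delta>. \<tau> \<in> {T\<^sub>0..T\<^sub>1} \<Longrightarrow> 0 < \<delta> \<Longrightarrow> \<delta> \<le> D \<Longrightarrow> local_error R f u \<tau> \<delta> \<le> M * \<delta> ^ (p + 1)"
proof -
  obtain M b where b: "b > 0"
    and M: "\<And>\<tau> \<delta>. 0 < \<delta> \<Longrightarrow> \<delta> < b \<Longrightarrow> \<tau> \<in> {T\<^sub>0..T\<^sub>1} \<Longrightarrow> local_error R f u \<tau> \<delta> \<le> M * \<delta> ^ (p + 1)"
    using assms(1) unfolding rk_order_def eventually_at_right_field by meson
  \<comment> \<open>The first entry serves \<open>\<delta> < b\<close>, with an absolute value
    because M may be negative; the second makes the bound at least \<open>E\<close> from
    \<open>\<delta> = b\<close> onwards.\<close>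
  define N where "N = max \<bar>M\<bar> (E / b ^ (p + 1))"
  have "local_error R f u \<tau> \<delta> \<le> N * \<delta> ^ (p + 1)"
    if \<tau>: "\<tau> \<in> {T\<^sub>0..T\<^sub>1}" and \<delta>: "0 < \<delta>" "\<delta> \<le> D" for \<tau> \<delta>
  proof (cases "\<delta> < b")
    case True
    have "M * \<delta> ^ (p + 1) \<le> N * \<delta> ^ (p + 1)"
      using \<delta> unfolding N_def by (intro mult_right_mono) auto
    with M[OF \<delta>(1) True \<tau>] show ?thesis
      by linarith
  next
    case False
    have "local_error R f u \<tau> \<delta> \<le> E / b ^ (p + 1) * b ^ (p + 1)"
      using bdd[OF \<tau>] \<delta> b by simp
    also have "\<dots> \<le> N * \<delta> ^ (p + 1)"
      using False b \<open>E \<ge> 0\<close> unfolding N_def by (intro mult_mono power_mono) auto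
    finally show ?thesis .
  qed
  moreover have "N \<ge> 0"
    unfolding N_def by simp
  ultimately show ?thesis
    using that by blast
qed

section \<open>Accumulation of the local errors\<close>

text \<open>Each of the i contributions \<open>b\<close> is amplified by at most
  \<open>exp (real i * a)\<close>. Unlike the geometric sum, this form needs no division by
  \<open>a\<close>, which may be 0, and keeps the number of steps as a factor.\<close>

lemma discrete_gronwall:
  fixes e :: "nat \<Rightarrow> real"
  assumes "e 0 \<le> 0" and step: "\<And>i. i < n \<Longrightarrow> e (Suc i) \<le> (1 + a) * e i + b"
    and "a \<ge> 0" "b \<ge> 0" and "i \<le> n"
  shows "e i \<le> real i * b * exp (real i * a)"
  using \<open>i \<le> n\<close>
proof (induction i)
  case 0
  then show ?case
    using assms(1) by simp
next
  case (Suc i)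
  have "e (Suc i) \<le> (1 + a) * e i + b"
    using Suc.prems step by simp
  \<comment> \<open>Besides \<open>1 + a \<le> exp a\<close>, the new term \<open>b\<close> is
    enlarged so that both summands share the factor \<open>exp (real (Suc i) * a)\<close>.\<close>
  also have "\<dots> \<le> exp a * (real i * b * exp (real i * a)) + b * exp (real (Suc i) * a)"
  proof (rule add_mono)
    have "(1 + a) * e i \<le> (1 + a) * (real i * b * exp (real i * a))"
      using Suc \<open>a \<ge> 0\<close> by (intro mult_left_mono) auto
    also have "\<dots> \<le> exp a * (real i * b * exp (real i * a))"
      using \<open>b \<ge> 0\<close> exp_ge_add_one_self[of a] by (intro mult_right_mono) auto
    finally show "(1 + a) * e i \<le> exp a * (real i * b * exp (real i * a))" .
    show "b \<le> b * exp (real (Suc i) * a)"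
      using \<open>a \<ge> 0\<close> \<open>b \<ge> 0\<close> mult_left_mono[of 1 "exp (real (Suc i) * a)" b] by simp
  qed
  also have "\<dots> = real (Suc i) * b * exp (real (Suc i) * a)"
    by (simp add: algebra_simps exp_add)
  finally show ?case .
qed

section \<open>The global error bound\<close>

theorem theorem2:
  fixes f :: "real \<Rightarrow> real \<Rightarrow> real"
    and u :: "real \<Rightarrow> real"
    and R :: rk_method
    and s p :: nat
    and L T\<^sub>0 T\<^sub>1 :: real
  assumes "ode_solution f u"
    and "\<And>\<tau>. deriv u differentiable (at \<tau>)"
    and "\<And>\<tau> v. f \<tau> differentiable (at v)"
    and "\<And>\<tau> v. \<bar>deriv (f \<tau>) v\<bar> \<le> L"
    and "L > 0"
    and "rk_stages R = s" and "s \<ge> 1"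
    and "rk_order R f u p"
  shows "\<exists>C>0. \<forall>t h. \<forall>K::nat. T\<^sub>0 \<le> t \<and> 0 < h \<and> t + h \<le> T\<^sub>1 \<and> K \<ge> 1 \<longrightarrow>
           \<bar>u (t + h) - unrolled_step R f t (u t) h K\<bar>
             \<le> (h / real K) ^ p * (C / L) * (exp (L * h) - 1)"
proof -
  \<comment> \<open>An upper bound for every admissible h; the maximum with 0 covers
    \<open>T\<^sub>1 < T\<^sub>0\<close>, where no h is admissible.\<close>
  define D where "D = max 0 (T\<^sub>1 - T\<^sub>0)"
  have D: "D \<ge> 0" and L: "L \<ge> 0"
    using \<open>L > 0\<close> by (auto simp: D_def)
  have lip: "\<bar>f \<tau> v - f \<tau> w\<bar> \<le> L * \<bar>v - w\<bar>" for \<tau> v w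
    using assms(3,4) by (rule lipschitz_of_deriv_bound)
  have u': "(u has_real_derivative f \<tau> (u \<tau>)) (at \<tau>)" for \<tau>
    using assms(1) unfolding ode_solution_def by blast
  have cont: "continuous_on UNIV u"
    using u' DERIV_isCont by (intro continuous_at_imp_continuous_on) blast
  \<comment> \<open>Twice differentiability of u enters here: it makes f continuous along the
    solution, although no continuity of f in time is assumed.\<close>
  have "deriv u = (\<lambda>\<tau>. f \<tau> (u \<tau>))"
    using u' DERIV_imp_deriv by blast
  moreover have "continuous_on UNIV (deriv u)"
    using assms(2) differentiable_imp_continuous_within
    by (intro continuous_at_imp_continuous_on) blast
  ultimately have cont': "continuous_on UNIV (\<lambda>\<tau>. f \<tau> (u \<tau>))"
    by simp
  obtain \<Lambda> where \<Lambda>: "\<Lambda> \<ge> 0" "\<And>\<tau> v w \<delta>. \<delta> \<in> {0..D} \<Longrightarrow>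
      \<bar>rk_step R f \<tau> v \<delta> - rk_step R f \<tau> w \<delta>\<bar> \<le> (1 + \<Lambda> * \<delta>) * \<bar>v - w\<bar>"
    by (rule rk_step_lipschitz[where f = f and R = R, OF lip L D]) (rule that)
  obtain E where E: "E \<ge> 0"
    "\<And>\<tau> \<delta>. \<tau> \<in> {T\<^sub>0..T\<^sub>1} \<Longrightarrow> \<delta> \<in> {0..D} \<Longrightarrow> local_error R f u \<tau> \<delta> \<le> E"
    by (rule local_error_bounded[where f = f and u = u, OF lip L D cont cont']) (rule that)
  obtain M where M: "M \<ge> 0"
    "\<And>\<tau> \<delta>. \<tau> \<in> {T\<^sub>0..T\<^sub>1} \<Longrightarrow> 0 < \<delta> \<Longrightarrow> \<delta> \<le> D \<Longrightarrow> local_error R f u \<tau> \<delta> \<le> M * \<delta> ^ (p + 1)"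
    by (rule rk_order_bound_all_steps[OF assms(8), of T\<^sub>0 T\<^sub>1 D E]) (use E in blast)+
  \<comment> \<open>Using \<open>D\<close> instead of h makes the constant uniform in t, h and K;
    adding 1 makes it positive even if \<open>M = 0\<close>.\<close>
  define C where "C = M * exp (\<Lambda> * D) + 1"
  have "C > 0"
    unfolding C_def using M(1) by (simp add: add_nonneg_pos)
  moreover have "\<bar>u (t + h) - unrolled_step R f t (u t) h K\<bar>
      \<le> (h / real K) ^ p * (C / L) * (exp (L * h) - 1)"
    if t: "T\<^sub>0 \<le> t" "t + h \<le> T\<^sub>1" and h: "0 < h" and K: "K \<ge> 1" for t h and K :: nat
  proof -
    define \<delta> where "\<delta> = h / real K"
    have \<delta>: "0 < \<delta>" "real K * \<delta> = h"
      unfolding \<delta>_def using h K by auto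
    have "h \<le> D"
      unfolding D_def using t by linarith
    have step_le: "real i * \<delta> \<le> h" if "i \<le> K" for i
      using that \<delta> mult_right_mono[of "real i" "real K" \<delta>] by simp
    then have "\<delta> \<le> D"
      using step_le[of 1] K \<open>h \<le> D\<close> by simp
    define e where "e i = \<bar>u (t + real i * \<delta>) - rk_iterate R f t (u t) \<delta> i\<bar>" for i
    \<comment> \<open>The step from the exact value \<open>u \<tau>\<close> is inserted between the
      exact and the computed next value: one difference is the local error, the other is the old
      error propagated by the method.\<close>
    have "e (Suc i) \<le> (1 + \<Lambda> * \<delta>) * e i + M * \<delta> ^ (p + 1)" if "i < K" for i
    proof -
      define \<tau> where "\<tau> = t + real i * \<delta>"
      have "\<tau> \<in> {T\<^sub>0..T\<^sub>1}"
        using step_le[of i] that t \<delta>(1) unfolding \<tau>_def by (auto simp: add_increasing2)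
      then have "local_error R f u \<tau> \<delta> \<le> M * \<delta> ^ (p + 1)"
        using M(2) \<delta>(1) \<open>\<delta> \<le> D\<close> by blast
      moreover have "\<bar>rk_step R f \<tau> (u \<tau>) \<delta> - rk_step R f \<tau> (rk_iterate R f t (u t) \<delta> i) \<delta>\<bar>
          \<le> (1 + \<Lambda> * \<delta>) * e i"
        using \<Lambda>(2) \<delta>(1) \<open>\<delta> \<le> D\<close> unfolding e_def \<tau>_def by simp
      moreover have next_time: "t + real (Suc i) * \<delta> = \<tau> + \<delta>"
        unfolding \<tau>_def by (simp add: algebra_simps)
      ultimately show ?thesis
        unfolding e_def local_error_def rk_iterate.simps next_time \<tau>_def[symmetric] by linarith
    qed
    then have "e K \<le> real K * (M * \<delta> ^ (p + 1)) * exp (real K * (\<Lambda> * \<delta>))"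
      using \<Lambda>(1) M(1) \<delta>(1) by (intro discrete_gronwall[of e K]) (auto simp: e_def)
    \<comment> \<open>One factor \<open>\<delta>\<close> of \<open>\<delta> ^ (p + 1)\<close> is
      absorbed by the number of steps, as \<open>real K * \<delta> = h\<close>.\<close>
    also have "\<dots> = \<delta> ^ p * (M * exp (\<Lambda> * h)) * h"
      unfolding \<delta>(2)[symmetric] by (simp add: algebra_simps)
    also have "\<dots> \<le> \<delta> ^ p * C * ((exp (L * h) - 1) / L)"
    proof (intro mult_mono mult_left_mono)
      have "M * exp (\<Lambda> * h) \<le> M * exp (\<Lambda> * D)"
        using M(1) \<Lambda>(1) \<open>h \<le> D\<close> by (simp add: mult_left_mono)
      then show "M * exp (\<Lambda> * h) \<le> C"
        unfolding C_def by linarith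
      show "h \<le> (exp (L * h) - 1) / L"
        using exp_ge_add_one_self[of "L * h"] \<open>L > 0\<close> by (simp add: field_simps)
    qed (use \<delta>(1) h M(1) \<open>C > 0\<close> in auto)
    also have "\<dots> = \<delta> ^ p * (C / L) * (exp (L * h) - 1)"
      by simp
    finally show ?thesis
      unfolding e_def unrolled_step_def \<delta>_def[symmetric] \<delta>(2) .
  qed
  ultimately show ?thesis
    by blast
qed

end
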